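(* $S'_2 = S_2$, that is, $S'_2(k) = S_2(k)$ for all integers $k \ge 0$.
   Context: For an integer $k \ge 0$, $S_2(k)$ denotes the smallest integer $n \ge 0$ such that $2^k$ divides $n!$, except that by convention $S_2(0) = 0$ (equivalently, $S_2(k)$ is the smallest integer $n \ge 0$ with $k \le \sum_{i=1}^n \mathrm{ord}_2(i)$, where $\mathrm{ord}_2(i)$ is the largest $m \ge 0$ such that $2^m$ divides $i$). The sequence $S'_2 : \mathbb{N}_0 \to \mathbb{N}_0$ (with $\mathbb{N}_0 = \{0,1,2,\dots\}$) is defined recursively: $S'_2(0) := 0$, $S'_2(1) := 2$, and for $k \ge 2$, $S'_2(k) := 2 \cdot (k-i+1)$ for the minimal $i \in \{1,\dots,k-1\}$ with $k-i+1 \le S'_2(i)$ (such an $i$ always exists). *)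

theory Defs
  imports Complex_Main
begin

text \<open>The convention \<open>S\<^sub>2(0) = 0\<close> needs no separate clause, since \<open>2 ^ 0\<close> divides \<open>0!\<close>;
  see \<open>S2_0\<close>. The minimum exists for every \<open>k\<close>; see \<open>S2_ex\<close>.\<close>

definition S2 :: "nat \<Rightarrow> nat" where
  "S2 k = (LEAST n. 2 ^ k dvd (fact n :: nat))"

lemma S2_0: "S2 0 = 0"
  by (simp add: S2_def)

lemma S2_ex: "\<exists>n. 2 ^ k dvd (fact n :: nat)"
  by (rule exI[of _ "2 ^ k"]) (simp add: dvd_fact)

text \<open>Congruence rules that let the termination proof see that the recursive calls below the
  binder are guarded by \<open>i \<in> {1..k - 1}\<close>.\<close>

lemma Least_fundef_cong [fundef_cong]:
  "(\<And>i. P i = Q i) \<Longrightarrow> Least P = Least Q"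
  by presburger

declare conj_cong [fundef_cong]

text \<open>In the last case \<open>i \<in> {1..k - 1}\<close>, so the subtraction \<open>k - i\<close> is not truncated. That such an
  \<open>i\<close> exists, i.e. that \<open>LEAST\<close> is meaningful, is \<open>S2'_ex\<close>.\<close>

function S2' :: "nat \<Rightarrow> nat" where
  "S2' k = (if k = 0 then 0 else if k = 1 then 2
     else 2 * (k - (LEAST i. i \<in> {1..k - 1} \<and> k - i + 1 \<le> S2' i) + 1))"
  by auto
termination
  by (relation "measure id") auto

declare S2'.simps [simp del]

lemma S2'_ge_2: "k \<ge> 1 \<Longrightarrow> S2' k \<ge> 2"
  by (subst S2'.simps) simp

lemma S2'_ex:
  assumes "k \<ge> 2"
  shows "\<exists>i\<in>{1..k - 1}. k - i + 1 \<le> S2' i"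
proof
  show "k - 1 \<in> {1..k - 1}"
    using assms by simp
  show "k - (k - 1) + 1 \<le> S2' (k - 1)"
    using assms S2'_ge_2[of "k - 1"] by linarith
qed

end

theory Submission
  imports Defs
begin

text \<open>
  Write \<open>(2 m)! = 2 ^ m * m! * c\<close> with \<open>c\<close> odd. For \<open>i \<le> k\<close> this gives
  \<open>2 ^ i dvd (k - i)! \<longleftrightarrow> 2 ^ k dvd (2 (k - i))!\<close>, that is,
  \<open>k - i < S2 i \<longleftrightarrow> 2 (k - i) < S2 k\<close>. Since \<open>S2 k\<close> is an even number \<open>2 s\<close>, the least \<open>i\<close> with
  \<open>k - i + 1 \<le> S2 i\<close> is the least one with \<open>k - i < s\<close>, for which \<open>k - i + 1 = s\<close>.
\<close>

lemma S2_le_iff: "S2 k \<le> n \<longleftrightarrow> 2 ^ k dvd (fact n :: nat)"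
proof
  assume "S2 k \<le> n"
  moreover have "2 ^ k dvd (fact (S2 k) :: nat)"
    unfolding S2_def using S2_ex by (rule LeastI_ex)
  ultimately show "2 ^ k dvd (fact n :: nat)"
    using dvd_trans fact_dvd by blast
qed (simp add: S2_def Least_le)

text \<open>The even factors of \<open>(2 * m)!\<close> contribute \<open>2 ^ m * m!\<close>;
  \<open>c\<close> is the product of the odd ones.\<close>

lemma fact_double_odd_cofactor: "\<exists>c. odd c \<and> (fact (2 * m) :: nat) = 2 ^ m * fact m * c"
proof (induction m)
  case 0
  show ?case by simp
next
  case (Suc m)
  then obtain c where c: "odd c" "(fact (2 * m) :: nat) = 2 ^ m * fact m * c"
    by blast
  have "(fact (2 * Suc m) :: nat) = (2 * m + 2) * ((2 * m + 1) * fact (2 * m))"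
    by simp
  also have "\<dots> = 2 ^ Suc m * fact (Suc m) * ((2 * m + 1) * c)"
    unfolding c(2) by (simp add: algebra_simps)
  finally show ?case
    using c(1) by (intro exI[of _ "(2 * m + 1) * c"]) simp
qed

lemma power2_dvd_mult_odd_iff:
  fixes a c :: nat
  assumes "odd c"
  shows "2 ^ j dvd a * c \<longleftrightarrow> 2 ^ j dvd a"
  using assms by (simp add: coprime_dvd_mult_left_iff)

lemma power2_dvd_fact_double_iff:
  "2 ^ (m + j) dvd (fact (2 * m) :: nat) \<longleftrightarrow> 2 ^ j dvd (fact m :: nat)"
proof -
  obtain c where c: "odd c" "(fact (2 * m) :: nat) = 2 ^ m * fact m * c"
    using fact_double_odd_cofactor by blast
  show ?thesis
    unfolding c(2) power2_dvd_mult_odd_iff[OF c(1)] by (simp add: power_add)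
qed

text \<open>An odd last factor adds no power of 2 to the factorial, so a minimal argument cannot be
  odd.\<close>

lemma even_S2: "even (S2 k)"
proof (rule ccontr)
  assume "odd (S2 k)"
  then obtain m where m: "S2 k = Suc (2 * m)"
    by (auto elim: oddE)
  have "2 ^ k dvd (fact (Suc (2 * m)) :: nat)"
    using S2_le_iff[of k "S2 k"] m by simp
  then have "2 ^ k dvd (fact (2 * m) * Suc (2 * m) :: nat)"
    by (simp add: algebra_simps)
  then have "S2 k \<le> 2 * m"
    \<comment> \<open>Expanding the product with \<open>mult_Suc_right\<close> would hide the odd
      factor \<open>Suc (2 * m)\<close>.\<close>
    by (simp add: power2_dvd_mult_odd_iff S2_le_iff del: mult_Suc_right)
  with m show False by simp
qed

lemma less_S2_iff:
  assumes "i \<le> k"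
  shows "k - i < S2 i \<longleftrightarrow> 2 * (k - i) < S2 k"
  using power2_dvd_fact_double_iff[of "k - i" i] assms
  by (simp add: not_le[symmetric] S2_le_iff)

text \<open>The case \<open>j = 0\<close>: already \<open>2 ^ k\<close> divides
  \<open>(2 * k)!\<close>.\<close>

lemma S2_le_double: "S2 k \<le> 2 * k"
  using power2_dvd_fact_double_iff[of k 0] by (simp add: S2_le_iff)

lemma S2_1: "S2 1 = 2"
proof -
  have "\<not> S2 1 \<le> 1" "S2 1 \<le> 2"
    unfolding S2_le_iff by (simp_all add: fact_2)
  then show ?thesis by simp
qed

lemma S2_gt_2:
  assumes "k \<ge> 2"
  shows "S2 k > 2"
proof (rule ccontr)
  assume "\<not> S2 k > 2"
  then have "2 ^ k dvd (2 :: nat)"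
    using S2_le_iff[of k 2] by (simp add: fact_2)
  moreover have "(2 :: nat) ^ 2 dvd 2 ^ k"
    using assms by (rule le_imp_power_dvd)
  ultimately have "(2 :: nat) ^ 2 dvd 2"
    by (rule dvd_trans[rotated])
  then show False by simp
qed

theorem theorem4p17: "S2' = S2"
proof
  fix k
  show "S2' k = S2 k"
  proof (induction k rule: less_induct)
    case (less k)
    consider "k = 0" | "k = 1" | "k \<ge> 2" by linarith
    then show ?case
    proof cases
      case 1
      then show ?thesis by (simp add: S2'.simps[of 0] S2_0)
    next
      case 2
      then show ?thesis using S2_1 by (subst S2'.simps) simp
    next
      case 3
      obtain s where s: "S2 k = 2 * s"
        using even_S2 by blast
      \<comment> \<open>These put the candidate \<open>k - s + 1\<close> into
        \<open>{1..k - 1}\<close>: \<open>2 \<le> s\<close> gives the upper end, and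
        \<open>s \<le> k\<close> keeps \<open>k - s\<close> untruncated.\<close>
      have bounds: "2 \<le> s" "s \<le> k"
        using S2_gt_2[OF 3] S2_le_double[of k] s by simp_all
      \<comment> \<open>Since \<open>i < k\<close>, the induction hypothesis turns
        \<open>S2' i\<close> into \<open>S2 i\<close>, and \<open>less_S2_iff\<close> then compares
        \<open>2 * (k - i)\<close> with \<open>2 * s\<close>.\<close>
      have iff: "i \<in> {1..k - 1} \<and> k - i + 1 \<le> S2' i \<longleftrightarrow> i \<in> {1..k - 1} \<and> k - i < s" for i
      proof (cases "i \<in> {1..k - 1}")
        case True
        then have "i < k" by auto
        with True show ?thesis
          using less.IH[of i] less_S2_iff[of i k] s by (simp add: Suc_le_eq)
      qed auto
      have "(LEAST i. i \<in> {1..k - 1} \<and> k - i + 1 \<le> S2' i) = k - s + 1"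
        unfolding iff using bounds by (intro Least_equality) auto
      with 3 bounds s show ?thesis
        by (subst S2'.simps) simp
    qed
  qed
qed

end
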